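(* For every even integer $d \ge 4$ and every $n \in \mathbb{N}^*$, the SONC cone $C_{n,d}$ is not closed under affine transformation of variables: there exist $f \in C_{n,d}$ and an (invertible) affine transformation $T:\mathbb{R}^n\to\mathbb{R}^n$ such that $f\circ T \notin C_{n,d}$.
   Context: $\mathbb{N}$ contains $0$ and $\mathbb{N}^* = \mathbb{N}\setminus\{0\}$. A circuit polynomial is a polynomial $f(\mathbf{x}) = \sum_{j=0}^r f_{\boldsymbol{\alpha}(j)} \mathbf{x}^{\boldsymbol{\alpha}(j)} + f_{\boldsymbol{\beta}} \mathbf{x}^{\boldsymbol{\beta}}$ in $\mathbb{R}[x_1,\dots,x_n]$ with $0\le r \le n$, exponents $\boldsymbol{\alpha}(j),\boldsymbol{\beta} \in \mathbb{N}^n$, $f_{\boldsymbol{\alpha}(j)} > 0$, $f_{\boldsymbol{\beta}} \in \mathbb{R}$, such that $\boldsymbol{\alpha}(0),\dots,\boldsymbol{\alpha}(r)$ lie in $(2\mathbb{N})^n$ and are affinely independent (so they are the vertices of a simplex), and $\boldsymbol{\beta}$ lies in the relative interior of that simplex. In particular, monomial squares $c\,\mathbf{x}^{\boldsymbol{\alpha}}$ with $c>0$ and $\boldsymbol{\alpha} \in (2\mathbb{N})^n$ count as (nonnegative) circuit polynomials. A circuit polynomial is nonnegative if it is nonnegative on all of $\mathbb{R}^n$. For even $D \ge 2$, $C_{n,D}$ is the set of SONC polynomials in $n$ variables of degree at most $D$: all $f=\sum_{i=1}^k \mu_i q_i$ of degree at most $D$ with $k\in\mathbb{N}^*$, $\mu_i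 \ge 0$ and $q_i$ nonnegative circuit polynomials. *)

theory Defs
  imports "HOL-Analysis.Analysis" "HOL-Library.Poly_Mapping"
begin

text \<open>
  A polynomial in real variables indexed by the finite type \<open>'n\<close> is a finitely supported map from
  exponent vectors to coefficients; the ring structure is the convolution product.
\<close>

type_synonym 'n rpoly = "(nat ^ 'n) \<Rightarrow>\<^sub>0 real"

abbreviation Const :: "real \<Rightarrow> ('n::finite) rpoly"
  where "Const c \<equiv> Poly_Mapping.single 0 c"

abbreviation Var :: "'n \<Rightarrow> ('n::finite) rpoly"
  where "Var i \<equiv> Poly_Mapping.single (axis i 1) 1"

text \<open>The zero polynomial gets degree 0.\<close>

definition total_degree :: "('n::finite) rpoly \<Rightarrow> nat"
  where "total_degree f = Max (insert 0 ((\<lambda>a. \<Sum>i\<in>UNIV. a $ i) ` Poly_Mapping.keys f))"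

definition eval_poly :: "('n::finite) rpoly \<Rightarrow> real ^ 'n \<Rightarrow> real"
  where "eval_poly f x = (\<Sum>a\<in>Poly_Mapping.keys f. Poly_Mapping.lookup f a * (\<Prod>i\<in>UNIV. (x $ i) ^ (a $ i)))"

definition subst_poly :: "('n \<Rightarrow> 'n rpoly) \<Rightarrow> ('n::finite) rpoly \<Rightarrow> 'n rpoly"
  where "subst_poly p f =
    (\<Sum>a\<in>Poly_Mapping.keys f. Const (Poly_Mapping.lookup f a) * (\<Prod>i\<in>UNIV. p i ^ (a $ i)))"

text \<open>
  The polynomial \<open>f \<circ> T\<close> for \<open>T x = A x + b\<close>; see \<open>eval_affine_subst\<close> below.
\<close>

definition affine_subst :: "real ^ 'n ^ 'n \<Rightarrow> real ^ 'n \<Rightarrow> ('n::finite) rpoly \<Rightarrow> 'n rpoly"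
  where "affine_subst A b = subst_poly (\<lambda>i. (\<Sum>j\<in>UNIV. Const (A $ i $ j) * Var j) + Const (b $ i))"

definition real_vec :: "nat ^ 'n \<Rightarrow> real ^ 'n"
  where "real_vec a = (\<chi> i. real (a $ i))"

text \<open>
  Affine independence of the family \<open>\<alpha> 0, \<dots>, \<alpha> r\<close> is injectivity together with affine
  independence of its range, since \<^const>\<open>affine_dependent\<close> is a predicate on sets.
  For \<open>r = 0\<close> the simplex is a point, which is its own relative interior, so then
  \<open>\<beta> = \<alpha> 0\<close>.
\<close>

definition circuit_poly :: "('n::finite) rpoly \<Rightarrow> bool"
  where "circuit_poly f \<longleftrightarrow>
    (\<exists>r (\<alpha> :: nat \<Rightarrow> nat ^ 'n) (\<beta> :: nat ^ 'n) (c :: nat \<Rightarrow> real) (c\<^sub>\<beta> :: real).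
       r \<le> CARD('n) \<and>
       (\<forall>j\<le>r. c j > 0) \<and>
       (\<forall>j\<le>r. \<forall>i. even (\<alpha> j $ i)) \<and>
       inj_on \<alpha> {..r} \<and>
       \<not> affine_dependent (real_vec ` \<alpha> ` {..r}) \<and>
       real_vec \<beta> \<in> rel_interior (convex hull (real_vec ` \<alpha> ` {..r})) \<and>
       f = (\<Sum>j\<le>r. Poly_Mapping.single (\<alpha> j) (c j)) + Poly_Mapping.single \<beta> c\<^sub>\<beta>)"

definition nonneg_circuit_poly :: "('n::finite) rpoly \<Rightarrow> bool"
  where "nonneg_circuit_poly f \<longleftrightarrow> circuit_poly f \<and> (\<forall>x. eval_poly f x \<ge> 0)"

text \<open>
  Only the sum is required to have degree at most \<open>D\<close>; no separate degree bound is imposed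
  on the summands.
\<close>

definition SONC :: "nat \<Rightarrow> ('n::finite) rpoly set"
  where "SONC D = {f. total_degree f \<le> D \<and>
    (\<exists>k (\<mu> :: nat \<Rightarrow> real) (q :: nat \<Rightarrow> 'n rpoly). k \<ge> 1 \<and>
       (\<forall>i\<in>{1..k}. \<mu> i \<ge> 0 \<and> nonneg_circuit_poly (q i)) \<and>
       f = (\<Sum>i=1..k. Const (\<mu> i) * q i))}"

lemma eval_poly_superset:
  assumes "finite S" "Poly_Mapping.keys f \<subseteq> S"
  shows "eval_poly f x = (\<Sum>a\<in>S. Poly_Mapping.lookup f a * (\<Prod>i\<in>UNIV. (x $ i) ^ (a $ i)))"
  unfolding eval_poly_def
  by (rule sum.mono_neutral_left) (use assms in \<open>auto simp: in_keys_iff\<close>)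

lemma eval_poly_zero [simp]: "eval_poly 0 x = 0"
  by (simp add: eval_poly_def)

lemma eval_poly_add: "eval_poly (f + g) x = eval_poly f x + eval_poly g x"
proof -
  let ?S = "Poly_Mapping.keys f \<union> Poly_Mapping.keys g"
  have "finite ?S" "Poly_Mapping.keys (f + g) \<subseteq> ?S"
    using Poly_Mapping.keys_add[of f g] by auto
  thus ?thesis
    by (simp add: eval_poly_superset[of ?S] lookup_add distrib_right sum.distrib)
qed

lemma eval_poly_single:
  "eval_poly (Poly_Mapping.single a c) x = c * (\<Prod>i\<in>UNIV. (x $ i) ^ (a $ i))"
  by (subst eval_poly_superset[of "{a}"]) (auto simp: lookup_single)

lemma eval_poly_sum: "eval_poly (\<Sum>i\<in>I. f i) x = (\<Sum>i\<in>I. eval_poly (f i) x)"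
  by (induction I rule: infinite_finite_induct) (auto simp: eval_poly_add)

lemma rpoly_eq_sum_single:
  "f = (\<Sum>a\<in>Poly_Mapping.keys f. Poly_Mapping.single a (Poly_Mapping.lookup f a))"
  by (rule poly_mapping_eqI) (auto simp: lookup_sum lookup_single when_def in_keys_iff)

lemma eval_poly_mult: "eval_poly (f * g) x = eval_poly f x * eval_poly g x"
proof -
  let ?F = "\<lambda>a. Poly_Mapping.single a (Poly_Mapping.lookup f a)"
  let ?G = "\<lambda>a. Poly_Mapping.single a (Poly_Mapping.lookup g a)"
  have "f * g = (\<Sum>a\<in>Poly_Mapping.keys f. ?F a) * (\<Sum>a\<in>Poly_Mapping.keys g. ?G a)"
    by (simp flip: rpoly_eq_sum_single)
  also have "eval_poly \<dots> x
      = (\<Sum>a\<in>Poly_Mapping.keys f. \<Sum>b\<in>Poly_Mapping.keys g. eval_poly (?F a * ?G b) x)"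
    by (simp add: sum_product eval_poly_sum)
  also have "\<dots> = (\<Sum>a\<in>Poly_Mapping.keys f. \<Sum>b\<in>Poly_Mapping.keys g.
      eval_poly (?F a) x * eval_poly (?G b) x)"
    by (simp add: mult_single eval_poly_single power_add prod.distrib algebra_simps)
  also have "\<dots> = eval_poly (\<Sum>a\<in>Poly_Mapping.keys f. ?F a) x *
      eval_poly (\<Sum>a\<in>Poly_Mapping.keys g. ?G a) x"
    by (simp add: sum_product eval_poly_sum)
  also have "\<dots> = eval_poly f x * eval_poly g x"
    by (simp flip: rpoly_eq_sum_single)
  finally show ?thesis .
qed

lemma eval_poly_Const [simp]: "eval_poly (Const c) x = c"
  by (simp add: eval_poly_single)

lemma eval_poly_one [simp]: "eval_poly 1 x = 1"
  using eval_poly_Const[of 1 x] by simp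

lemma eval_poly_Var [simp]: "eval_poly (Var j) x = x $ j"
proof -
  have "(\<Prod>i\<in>UNIV. (x $ i) ^ (axis j 1 $ i)) = (\<Prod>i\<in>UNIV. if i = j then x $ i else 1)"
    by (rule prod.cong) (auto simp: axis_def)
  thus ?thesis
    by (simp add: eval_poly_single)
qed

lemma eval_poly_power: "eval_poly (f ^ m) x = eval_poly f x ^ m"
  by (induction m) (auto simp: eval_poly_mult)

lemma eval_poly_prod: "eval_poly (\<Prod>i\<in>I. f i) x = (\<Prod>i\<in>I. eval_poly (f i) x)"
  by (induction I rule: infinite_finite_induct) (auto simp: eval_poly_mult)

lemma eval_affine_subst: "eval_poly (affine_subst A b f) x = eval_poly f (A *v x + b)"
  by (simp add: affine_subst_def subst_poly_def eval_poly_sum eval_poly_mult eval_poly_prod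
      eval_poly_power eval_poly_add eval_poly_def[of f] matrix_vector_mult_def del: One_nat_def)

end

theory Submission
  imports Defs
begin

text \<open>
  On the ray \<open>x = - exp u (1, \<dots>, 1)\<close> a circuit polynomial divided by the absolute value of its
  inner monomial is a positive combination of exponentials in \<open>u\<close> plus a constant, hence convex
  in \<open>u\<close>. So a nonnegative circuit polynomial, and therefore a SONC polynomial, that vanishes at
  \<open>-2 (1, \<dots>, 1)\<close> and \<open>-8 (1, \<dots>, 1)\<close> also vanishes at their geometric mean \<open>-4 (1, \<dots>, 1)\<close>.
  The circuit polynomial \<open>(x\<^sub>i\<^sup>2 - 9)\<^sup>2\<close>, translated by \<open>5\<close> in every variable, violates this.
\<close>

text \<open>On the diagonal the problem becomes univariate: only the total degrees of the exponents
  matter.\<close>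

lemma eval_poly_single_vec:
  "eval_poly (Poly_Mapping.single a c :: ('n::finite) rpoly) (vec t) = c * t ^ (\<Sum>i\<in>UNIV. a $ i)"
  by (simp add: eval_poly_single power_sum)

lemma eval_poly_single_axis:
  "eval_poly (Poly_Mapping.single (axis i k) c :: ('n::finite) rpoly) x = c * x $ i ^ k"
proof -
  have "(\<Prod>j\<in>UNIV. x $ j ^ (axis i k $ j)) = (\<Prod>j\<in>UNIV. if j = i then x $ i ^ k else 1)"
    by (rule prod.cong) (auto simp: axis_def)
  thus ?thesis
    by (simp add: eval_poly_single)
qed

text \<open>With w = u / v the difference of the two sides is w (w - 1)^2. This is midpoint
  convexity of an exponential, whose values at 2, 4, 8 are w, w^2, w^3.\<close>

lemma geometric_mean_convex:
  fixes u v :: real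
  assumes "u > 0" "v > 0"
  shows "2 * u\<^sup>2 / v\<^sup>2 \<le> u / v + u ^ 3 / v ^ 3"
proof -
  have "0 \<le> (u / v) * (u / v - 1)\<^sup>2"
    using assms by simp
  also have "\<dots> = u / v + u ^ 3 / v ^ 3 - 2 * u\<^sup>2 / v\<^sup>2"
    by (simp add: power2_eq_square power3_eq_cube algebra_simps)
  finally show ?thesis by simp
qed

lemma circuit_poly_zeros_geometric_mean:
  fixes q :: "('n::finite) rpoly"
  assumes "circuit_poly q" "eval_poly q (vec (- 2)) = 0" "eval_poly q (vec (- 8)) = 0"
  shows "eval_poly q (vec (- 4)) \<le> 0"
proof -
  obtain r and \<alpha> :: "nat \<Rightarrow> nat ^ 'n" and \<beta> :: "nat ^ 'n" and c e where
    c: "\<forall>j\<le>r. c j > 0" and ev: "\<forall>j\<le>r. \<forall>i. even (\<alpha> j $ i)" and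
    q: "q = (\<Sum>j\<le>r. Poly_Mapping.single (\<alpha> j) (c j)) + Poly_Mapping.single \<beta> e"
    using assms(1) unfolding circuit_poly_def by blast
  define a where "a j = (\<Sum>i\<in>UNIV. \<alpha> j $ i)" for j
  define s where "s = (\<Sum>i\<in>UNIV. \<beta> $ i)"
  \<comment> \<open>The outer terms have even total degree and ignore the sign of the argument; the
    sign of the inner term is absorbed into its coefficient.\<close>
  define e' where "e' = e * (- 1) ^ s"
  have "even (a j)" if "j \<le> r" for j
    using ev that unfolding a_def by (auto intro: dvd_sum)
  hence "eval_poly q (vec (- t)) = (\<Sum>j\<le>r. c j * t ^ a j) + e' * t ^ s" for t
    unfolding q
    by (simp add: eval_poly_add eval_poly_sum eval_poly_single_vec power_minus[of t s] e'_def
        flip: a_def s_def)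
  hence eval: "eval_poly q (vec (- t)) = t ^ s * ((\<Sum>j\<le>r. c j * (t ^ a j / t ^ s)) + e')"
    if "t > 0" for t
    using that by (simp add: sum_distrib_left algebra_simps)
  \<comment> \<open>Prepares the convexity inequality for u = \<open>2 ^ a j\<close> and v =
    \<open>2 ^ s\<close>.\<close>
  have pw: "(4::real) ^ m = (2 ^ m)\<^sup>2" "(8::real) ^ m = (2 ^ m) ^ 3" for m
    by (simp_all flip: power_mult power_mult[of _ _ m] add: mult.commute[of m] power_mult)
  have "2 * (\<Sum>j\<le>r. c j * (4 ^ a j / 4 ^ s)) = (\<Sum>j\<le>r. c j * (2 * 4 ^ a j / 4 ^ s))"
    by (simp add: sum_distrib_left mult_ac)
  also have "\<dots> \<le>
      (\<Sum>j\<le>r. c j * (2 ^ a j / 2 ^ s + 8 ^ a j / 8 ^ s))"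
    unfolding pw using c
    by (intro sum_mono mult_left_mono geometric_mean_convex) (auto intro: less_imp_le)
  also have "\<dots> = (\<Sum>j\<le>r. c j * (2 ^ a j / 2 ^ s)) + (\<Sum>j\<le>r. c j * (8 ^ a j / 8 ^ s))"
    by (simp add: distrib_left sum.distrib)
  \<comment> \<open>At 2 and 8 the factor \<open>t ^ s\<close> is positive, so both brackets in
    \<open>eval\<close> vanish and each sum equals \<open>- e'\<close>.\<close>
  also have "\<dots> = - 2 * e'"
    using assms(2,3) eval[of 2] eval[of 8] by simp
  finally have "(\<Sum>j\<le>r. c j * (4 ^ a j / 4 ^ s)) + e' \<le> 0"
    by simp
  thus ?thesis
    using eval[of 4] by (simp add: mult_nonneg_nonpos)
qed

text \<open>At a zero of \<open>f\<close> every weighted summand vanishes, since all are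
  nonnegative. A circuit polynomial of nonzero weight thus inherits both zeros, and its upper bound
  0 at the third point meets nonnegativity.\<close>

lemma SONC_zeros_geometric_mean:
  fixes f :: "('n::finite) rpoly"
  assumes "f \<in> SONC D" "eval_poly f (vec (- 2)) = 0" "eval_poly f (vec (- 8)) = 0"
  shows "eval_poly f (vec (- 4)) = 0"
proof -
  obtain k and \<mu> :: "nat \<Rightarrow> real" and q :: "nat \<Rightarrow> 'n rpoly" where
    q: "\<And>i. i \<in> {1..k} \<Longrightarrow> \<mu> i \<ge> 0 \<and> nonneg_circuit_poly (q i)" and
    f: "f = (\<Sum>i=1..k. Const (\<mu> i) * q i)"
    using assms(1) unfolding SONC_def by blast
  have eval: "eval_poly f x = (\<Sum>i=1..k. \<mu> i * eval_poly (q i) x)" for x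
    by (simp add: f eval_poly_sum eval_poly_mult)
  have nonneg: "eval_poly (q i) x \<ge> 0" if "i \<in> {1..k}" for i x
    using q[OF that] by (simp add: nonneg_circuit_poly_def)
  have zero: "\<mu> i * eval_poly (q i) x = 0" if "eval_poly f x = 0" "i \<in> {1..k}" for i x
    using that q nonneg unfolding eval
    by (subst (asm) sum_nonneg_eq_0_iff) auto
  have "\<mu> i * eval_poly (q i) (vec (- 4)) = 0" if i: "i \<in> {1..k}" for i
  proof (cases "\<mu> i = 0")
    case False
    hence "eval_poly (q i) (vec (- 2)) = 0" "eval_poly (q i) (vec (- 8)) = 0"
      using zero[OF assms(2) i] zero[OF assms(3) i] by auto
    hence "eval_poly (q i) (vec (- 4)) \<le> 0"
      using q[OF i] by (intro circuit_poly_zeros_geometric_mean) (auto simp: nonneg_circuit_poly_def)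
    thus ?thesis
      using nonneg[OF i, of "vec (- 4)"] by simp
  qed simp
  thus ?thesis
    unfolding eval by (intro sum.neutral) blast
qed

definition double_well :: "'n \<Rightarrow> ('n::finite) rpoly"
  where "double_well i = Poly_Mapping.single 0 81 + Poly_Mapping.single (axis i 4) 1
    + Poly_Mapping.single (axis i 2) (- 18)"

lemma eval_double_well: "eval_poly (double_well i) x = ((x $ i)\<^sup>2 - 9)\<^sup>2"
  by (simp add: double_well_def eval_poly_add eval_poly_single_axis power2_eq_square
      power4_eq_xxxx algebra_simps del: single_numeral)

text \<open>The simplex is a segment along one axis, so \<open>r = 1\<close> fits every
  dimension.\<close>

lemma circuit_poly_double_well: "circuit_poly (double_well i :: ('n::finite) rpoly)"
proof -
  define \<alpha> :: "nat \<Rightarrow> nat ^ 'n" where "\<alpha> j = axis i (4 * j)" for j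
  define c :: "nat \<Rightarrow> real" where "c j = (if j = 0 then 81 else 1)" for j
  have r: "{..1::nat} = {0, 1}" by auto
  have im: "real_vec ` \<alpha> ` {..1} = {0, axis i 4}"
    unfolding r by (auto simp: \<alpha>_def real_vec_def axis_def vec_eq_iff split: if_splits)
  \<comment> \<open>Distinct endpoints make the relative interior the open segment, which contains
    the midpoint.\<close>
  have ne: "(0::real^'n) \<noteq> axis i 4"
    by (auto simp: vec_eq_iff axis_def)
  have "real_vec (axis i 2) = midpoint 0 (axis i 4 :: real ^ 'n)"
    by (auto simp: real_vec_def midpoint_def axis_def vec_eq_iff)
  hence "real_vec (axis i 2) \<in> rel_interior (convex hull (real_vec ` \<alpha> ` {..1}))"
    using ne unfolding im
    by (simp add: rel_interior_closed_segment flip: segment_convex_hull)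
  moreover have "\<not> affine_dependent (real_vec ` \<alpha> ` {..1})"
    unfolding im by (rule affine_independent_2)
  moreover have "inj_on \<alpha> {..1}"
    by (auto simp: inj_on_def \<alpha>_def axis_eq_axis)
  moreover have "\<forall>j\<le>1. \<forall>k. even (\<alpha> j $ k)"
    by (auto simp: \<alpha>_def axis_def)
  moreover have "double_well i =
      (\<Sum>j\<le>1. Poly_Mapping.single (\<alpha> j) (c j)) + Poly_Mapping.single (axis i 2) (- 18)"
  proof -
    have "\<alpha> 0 = 0" "\<alpha> 1 = axis i 4"
      by (simp_all add: \<alpha>_def)
    thus ?thesis
      unfolding r by (simp add: double_well_def c_def)
  qed
  moreover have "\<forall>j\<le>1. c j > 0"
    by (auto simp: c_def)
  moreover have "1 \<le> CARD('n)"
    by (simp add: Suc_leI)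
  ultimately show ?thesis
    unfolding circuit_poly_def by blast
qed

lemma total_degree_double_well: "total_degree (double_well i :: ('n::finite) rpoly) \<le> 4"
proof -
  have "Poly_Mapping.keys (double_well i :: 'n rpoly) \<subseteq> {0, axis i 4, axis i 2}"
    unfolding double_well_def
    by (auto simp: in_keys_iff lookup_add lookup_single when_def simp del: single_numeral split: if_splits)
  moreover have "(\<Sum>j\<in>UNIV. axis i m $ j) = m" for m :: nat
    by (simp add: axis_def if_distrib)
  ultimately show ?thesis
    unfolding total_degree_def by (auto dest!: subsetD)
qed

lemma double_well_in_SONC: "d \<ge> 4 \<Longrightarrow> double_well i \<in> SONC d"
proof -
  assume "d \<ge> 4"
  moreover have "nonneg_circuit_poly (double_well i)"
    by (simp add: nonneg_circuit_poly_def circuit_poly_double_well eval_double_well)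
  moreover have "double_well i = (\<Sum>k=1..(1::nat). Const 1 * double_well i)"
    by simp
  ultimately show ?thesis
    unfolding SONC_def using total_degree_double_well[of i]
    by (intro CollectI conjI exI[of _ 1] exI[of _ "\<lambda>_. 1"] exI[of _ "\<lambda>_. double_well i"]) auto
qed

theorem corollary3p2:
  fixes d :: nat
  assumes "even d" and "d \<ge> 4"
  shows "\<exists>f \<in> (SONC d :: ('n::finite) rpoly set).
           \<exists>(A :: real ^ 'n ^ 'n) (b :: real ^ 'n).
             invertible A \<and> affine_subst A b f \<notin> SONC d"
proof -
  obtain i :: 'n where True by simp
  \<comment> \<open>The zeros 3 and -3 of the double well move to t = -2 and t = -8, whereas t = -4
    is sent to 1, where the value is 64.\<close>
  let ?g = "affine_subst (mat 1) (vec 5) (double_well i)"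
  have eval: "eval_poly ?g (vec t) = ((t + 5)\<^sup>2 - 9)\<^sup>2" for t
    by (simp add: eval_affine_subst eval_double_well)
  have "?g \<notin> SONC d"
    using SONC_zeros_geometric_mean[of ?g d] by (auto simp: eval)
  moreover have "invertible (mat 1 :: real ^ 'n ^ 'n)"
    by (auto simp: invertible_def intro!: exI[of _ "mat 1"])
  ultimately show ?thesis
    using double_well_in_SONC[OF assms(2)] by blast
qed

end
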